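(* Let $G=(V,E)$ be a graph with $|E|\geq 1$. Then the following statements are equivalent: (a) $(I_G)_1\neq 0$, i.e. the cut ideal $I_G$ contains a nonzero linear form; (b) $G$ is disconnected.
   Context: $\mathbb{K}$ is a field. All graphs are finite and simple with non-empty vertex set. For a graph $G=(V,E)$ let $S_G=\mathbb{K}[q_{A|B}]$ be the polynomial ring with one variable for each unordered partition $A|B$ of $V$ (i.e. $A\cup B=V$, $A\cap B=\emptyset$, empty parts allowed), standard graded with every variable in degree $1$, and $R_G=\mathbb{K}[s_{ij},t_{ij}:\{i,j\}\in E]$. Let $\mathrm{Cut}(A|B)\subseteq E$ be the set of edges with one endpoint in $A$ and the other in $B$. Let $\phi_G\colon S_G\to R_G$ be the $\mathbb{K}$-algebra homomorphism $q_{A|B}\mapsto \prod_{\{i,j\}\in \mathrm{Cut}(A|B)}s_{ij}\prod_{\{i,j\}\in E\setminus \mathrm{Cut}(A|B)}t_{ij}$. The cut ideal is $I_G=\ker\phi_G$; it is a graded ideal of $S_G$, and $(I_G)_1$ denotes its degree-$1$ component. *)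

theory Defs
  imports "HOL-Library.Poly_Mapping"
begin

section \<open>Polynomial rings\<close>

text \<open>
  \<open>('x, 'k) mpoly\<close> is the polynomial ring over \<open>'k\<close> in the variables \<open>'x\<close>, realised as the
  monoid algebra of the monomials \<open>'x \<Rightarrow>\<^sub>0 nat\<close>; the ring operations on it are those of the library
  theory \<open>Poly_Mapping\<close>. The polynomial ring in a set \<open>X\<close> of variables is the subring \<open>poly_ring X\<close>.
\<close>

type_synonym ('x, 'k) mpoly = "('x \<Rightarrow>\<^sub>0 nat) \<Rightarrow>\<^sub>0 'k"

definition const :: "'k::comm_ring_1 \<Rightarrow> ('x, 'k) mpoly" where
  "const c = Poly_Mapping.single 0 c"

definition var :: "'x \<Rightarrow> ('x, 'k::comm_ring_1) mpoly" where
  "var x = Poly_Mapping.single (Poly_Mapping.single x 1) 1"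

definition poly_ring :: "'x set \<Rightarrow> ('x, 'k::comm_ring_1) mpoly set" where
  "poly_ring X = {p. \<forall>m \<in> Poly_Mapping.keys p. Poly_Mapping.keys m \<subseteq> X}"

definition mdegree :: "('x \<Rightarrow>\<^sub>0 nat) \<Rightarrow> nat" where
  "mdegree m = (\<Sum>x\<in>Poly_Mapping.keys m. Poly_Mapping.lookup m x)"

text \<open>The elements of \<open>I\<close> that are zero or homogeneous of degree \<open>d\<close> in the standard grading.\<close>

definition graded_part :: "nat \<Rightarrow> ('x, 'k::comm_ring_1) mpoly set \<Rightarrow> ('x, 'k) mpoly set" where
  "graded_part d I = {p \<in> I. \<forall>m \<in> Poly_Mapping.keys p. mdegree m = d}"

text \<open>The algebra homomorphism sending each variable \<open>x\<close> to \<open>f x\<close>, see the lemmas \<open>subst_\<dots>\<close> below.\<close>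

definition subst :: "('x \<Rightarrow> ('y, 'k::comm_ring_1) mpoly) \<Rightarrow> ('x, 'k) mpoly \<Rightarrow> ('y, 'k) mpoly" where
  "subst f p = (\<Sum>m\<in>Poly_Mapping.keys p. const (Poly_Mapping.lookup p m) *
      (\<Prod>x\<in>Poly_Mapping.keys m. f x ^ Poly_Mapping.lookup m x))"


section \<open>Graphs and cuts\<close>

definition simple_graph :: "'v set \<Rightarrow> 'v set set \<Rightarrow> bool" where
  "simple_graph V E \<longleftrightarrow> finite V \<and> V \<noteq> {} \<and> (\<forall>e\<in>E. e \<subseteq> V \<and> card e = 2)"

definition graph_connected :: "'v set \<Rightarrow> 'v set set \<Rightarrow> bool" where
  "graph_connected V E \<longleftrightarrow> (\<forall>u\<in>V. \<forall>v\<in>V. (u, v) \<in> {(x, y). {x, y} \<in> E}\<^sup>*)"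

text \<open>
  The unordered partition \<open>A|B\<close> is the set \<open>{A, B}\<close>; the partition with an empty part is \<open>{V, {}}\<close>.
\<close>

definition partitions2 :: "'v set \<Rightarrow> 'v set set set" where
  "partitions2 V = {{A, B} | A B. A \<union> B = V \<and> A \<inter> B = {}}"

definition cut :: "'v set set \<Rightarrow> 'v set set \<Rightarrow> 'v set set" where
  "cut E P = {e \<in> E. \<exists>A\<in>P. \<exists>B\<in>P. A \<noteq> B \<and> (\<exists>i\<in>A. \<exists>j\<in>B. e = {i, j})}"

lemma cut_pair:
  assumes "A \<inter> B = {}"
  shows "cut E {A, B} = {e \<in> E. \<exists>i\<in>A. \<exists>j\<in>B. e = {i, j}}"
  using assms unfolding cut_def by (auto simp: insert_commute)


section \<open>The cut ideal\<close>

text \<open>\<open>S e\<close> and \<open>T e\<close> are the indices of the variables written $s_e$ and $t_e$.\<close>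

datatype 'v edge_var = S "'v set" | T "'v set"

definition cut_monomial :: "'v set set \<Rightarrow> 'v set set \<Rightarrow> ('v edge_var, 'k::comm_ring_1) mpoly" where
  "cut_monomial E P = (\<Prod>e\<in>cut E P. var (S e)) * (\<Prod>e\<in>E - cut E P. var (T e))"

definition cut_hom ::
    "'v set set \<Rightarrow> ('v set set, 'k::comm_ring_1) mpoly \<Rightarrow> ('v edge_var, 'k) mpoly" where
  "cut_hom E = subst (cut_monomial E)"

definition cut_ideal :: "'v set \<Rightarrow> 'v set set \<Rightarrow> ('v set set, 'k::comm_ring_1) mpoly set" where
  "cut_ideal V E = {p \<in> poly_ring (partitions2 V). cut_hom E p = 0}"


section \<open>The substitution map is an algebra homomorphism\<close>

lemma const_0 [simp]: "const 0 = 0"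
  by (simp add: const_def)

lemma const_1 [simp]: "const 1 = 1"
  by (simp add: const_def)

lemma const_add: "const (a + b) = const a + const b"
  by (simp add: const_def single_add)

lemma const_mult: "const (a * b) = const a * const b"
  by (simp add: const_def mult_single)

lemma subst_superset:
  assumes "finite M" "Poly_Mapping.keys p \<subseteq> M"
  shows "subst f p = (\<Sum>m\<in>M. const (Poly_Mapping.lookup p m) *
      (\<Prod>x\<in>Poly_Mapping.keys m. f x ^ Poly_Mapping.lookup m x))"
  unfolding subst_def
  by (rule sum.mono_neutral_left) (use assms in \<open>auto simp: in_keys_iff\<close>)

lemma subst_add: "subst f (p + q) = subst f p + subst f q"
proof -
  let ?M = "Poly_Mapping.keys p \<union> Poly_Mapping.keys q"
  have "Poly_Mapping.keys (p + q) \<subseteq> ?M"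
    by (rule Poly_Mapping.keys_add)
  then show ?thesis
    using subst_superset[of ?M "p + q" f] subst_superset[of ?M p f] subst_superset[of ?M q f]
    by (simp add: lookup_add const_add distrib_right sum.distrib)
qed

lemma subst_0 [simp]: "subst f 0 = 0"
  by (simp add: subst_def)

lemma subst_sum: "subst f (\<Sum>i\<in>I. g i) = (\<Sum>i\<in>I. subst f (g i))"
  by (induction I rule: infinite_finite_induct) (auto simp: subst_add)

lemma subst_single:
  "subst f (Poly_Mapping.single m c) =
     const c * (\<Prod>x\<in>Poly_Mapping.keys m. f x ^ Poly_Mapping.lookup m x)"
  by (cases "c = 0") (auto simp: subst_def)

lemma subst_const: "subst f (const c) = const c"
  by (simp add: const_def subst_single)

lemma subst_var: "subst f (var x) = f x"
  by (simp add: var_def subst_single)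

lemma monomial_subst_add:
  fixes f :: "'x \<Rightarrow> 'a::comm_monoid_mult" and m n :: "'x \<Rightarrow>\<^sub>0 nat"
  shows "(\<Prod>x\<in>Poly_Mapping.keys (m + n). f x ^ Poly_Mapping.lookup (m + n) x) =
    (\<Prod>x\<in>Poly_Mapping.keys m. f x ^ Poly_Mapping.lookup m x) *
    (\<Prod>x\<in>Poly_Mapping.keys n. f x ^ Poly_Mapping.lookup n x)"
proof -
  let ?X = "Poly_Mapping.keys m \<union> Poly_Mapping.keys n"
  have *: "(\<Prod>x\<in>Poly_Mapping.keys k. f x ^ Poly_Mapping.lookup k x) =
      (\<Prod>x\<in>?X. f x ^ Poly_Mapping.lookup k x)" if "Poly_Mapping.keys k \<subseteq> ?X" for k :: "'x \<Rightarrow>\<^sub>0 nat"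
    by (rule prod.mono_neutral_left) (use that in \<open>auto simp: in_keys_iff\<close>)
  show ?thesis
    using *[OF Poly_Mapping.keys_add] *[of m] *[of n]
    by (simp add: lookup_add power_add prod.distrib)
qed

lemma sum_single_keys:
  "(\<Sum>m\<in>Poly_Mapping.keys p. Poly_Mapping.single m (Poly_Mapping.lookup p m)) = p"
  by (rule poly_mapping_eqI) (auto simp: lookup_sum lookup_single when_def in_keys_iff)

lemma subst_mult: "subst f (p * q) = subst f p * subst f q"
proof -
  let ?s = "\<lambda>r m. Poly_Mapping.single m (Poly_Mapping.lookup r m)"
  have single: "subst f (Poly_Mapping.single m c * Poly_Mapping.single n d) =
      subst f (Poly_Mapping.single m c) * subst f (Poly_Mapping.single n d)" for m n c d
    by (simp add: mult_single subst_single const_mult monomial_subst_add mult_ac)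
  have "subst f (p * q) = subst f ((\<Sum>m\<in>Poly_Mapping.keys p. ?s p m) *
      (\<Sum>n\<in>Poly_Mapping.keys q. ?s q n))"
    by (simp add: sum_single_keys)
  also have "\<dots> = subst f (\<Sum>m\<in>Poly_Mapping.keys p. ?s p m) *
      subst f (\<Sum>n\<in>Poly_Mapping.keys q. ?s q n)"
    by (simp only: sum_product subst_sum single)
  finally show ?thesis
    by (simp add: sum_single_keys)
qed


section \<open>The codomain of the cut homomorphism\<close>

lemma poly_ring_const [intro]: "const c \<in> poly_ring X"
  by (auto simp: poly_ring_def const_def)

lemma poly_ring_1 [intro]: "1 \<in> poly_ring X"
  using poly_ring_const[of 1] by simp

lemma poly_ring_var [intro]: "x \<in> X \<Longrightarrow> var x \<in> poly_ring X"
  by (auto simp: poly_ring_def var_def)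

lemma poly_ring_mult: "p \<in> poly_ring X \<Longrightarrow> q \<in> poly_ring X \<Longrightarrow> p * q \<in> poly_ring X"
  unfolding poly_ring_def mem_Collect_eq
proof
  fix m
  assume *: "\<forall>m\<in>Poly_Mapping.keys p. Poly_Mapping.keys m \<subseteq> X"
      "\<forall>m\<in>Poly_Mapping.keys q. Poly_Mapping.keys m \<subseteq> X"
    and "m \<in> Poly_Mapping.keys (p * q)"
  then obtain a b where "a \<in> Poly_Mapping.keys p" "b \<in> Poly_Mapping.keys q" "m = a + b"
    using keys_mult[of p q] by blast
  with * show "Poly_Mapping.keys m \<subseteq> X"
    using Poly_Mapping.keys_add[of a b] by blast
qed

lemma poly_ring_prod: "(\<And>i. i \<in> I \<Longrightarrow> g i \<in> poly_ring X) \<Longrightarrow> (\<Prod>i\<in>I. g i) \<in> poly_ring X"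
  by (induction I rule: infinite_finite_induct) (auto intro: poly_ring_mult)

lemma poly_ring_power: "p \<in> poly_ring X \<Longrightarrow> p ^ n \<in> poly_ring X"
  by (induction n) (auto intro: poly_ring_mult)

lemma poly_ring_sum: "(\<And>i. i \<in> I \<Longrightarrow> g i \<in> poly_ring X) \<Longrightarrow> (\<Sum>i\<in>I. g i) \<in> poly_ring X"
  unfolding poly_ring_def using keys_sum[of g I] by blast

lemma cut_hom_var: "cut_hom E (var P) = cut_monomial E P"
  by (simp add: cut_hom_def subst_var)

lemma cut_hom_in_poly_ring: "cut_hom E p \<in> poly_ring (S ` E \<union> T ` E)"
proof -
  have "cut_monomial E P \<in> poly_ring (S ` E \<union> T ` E)" for P
    unfolding cut_monomial_def by (intro poly_ring_mult poly_ring_prod poly_ring_var) (auto simp: cut_def)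
  then show ?thesis
    unfolding cut_hom_def subst_def
    by (intro poly_ring_sum poly_ring_mult poly_ring_prod poly_ring_power poly_ring_const)
qed

end

(* Every q_P is mapped to a monomial, and that monomial determines the cut of P and is determined
   by it. Hence the kernel contains a nonzero linear form iff two different partitions have the same
   cut. The cut of A|B tells for each edge whether its endpoints lie on the same side, so in a
   connected graph it determines A up to exchanging the two sides. If C is the set of vertices
   reachable from u in a disconnected graph, then C|(V - C) and V|{} both have the empty cut. *)

theory Submission
  imports Defs
begin

text \<open>The exponent vector of \<open>cut_monomial E P\<close>; comparing images of variables
  thus becomes comparing exponents.\<close>

definition cut_exponent :: "'v set set \<Rightarrow> 'v set set \<Rightarrow> 'v edge_var \<Rightarrow>\<^sub>0 nat" where
  "cut_exponent E P = (\<Sum>e\<in>cut E P. Poly_Mapping.single (S e) 1) +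
     (\<Sum>e\<in>E - cut E P. Poly_Mapping.single (T e) 1)"

lemma prod_single_1:
  "(\<Prod>i\<in>I. Poly_Mapping.single (g i) (1::'k::comm_ring_1)) =
     Poly_Mapping.single (\<Sum>i\<in>I. g i :: 'a::comm_monoid_add) 1"
  by (induction I rule: infinite_finite_induct) (auto simp: mult_single)

lemma cut_monomial_eq_single:
  "(cut_monomial E P :: ('v edge_var, 'k::comm_ring_1) mpoly) =
     Poly_Mapping.single (cut_exponent E P) 1"
  by (simp add: cut_monomial_def cut_exponent_def var_def prod_single_1 mult_single)

lemma lookup_cut_exponent_S:
  assumes "finite E"
  shows "Poly_Mapping.lookup (cut_exponent E P) (S e) = (if e \<in> cut E P then 1 else 0)"
proof -
  have "finite (cut E P)"
    using assms by (rule rev_finite_subset) (auto simp: cut_def)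
  then show ?thesis
    by (simp add: cut_exponent_def lookup_add lookup_sum lookup_single when_def)
qed

text \<open>The exponents of the variables \<open>S e\<close> form the indicator function of the
  cut, so they alone recover it.\<close>

lemma cut_exponent_eq_iff:
  assumes "finite E"
  shows "cut_exponent E P = cut_exponent E Q \<longleftrightarrow> cut E P = cut E Q"
proof
  assume "cut_exponent E P = cut_exponent E Q"
  then have "e \<in> cut E P \<longleftrightarrow> e \<in> cut E Q" for e
    using lookup_cut_exponent_S[OF assms] by (metis zero_neq_one)
  then show "cut E P = cut E Q"
    by blast
qed (simp add: cut_exponent_def)

lemma mdegree_eq_1E:
  assumes "mdegree m = 1"
  obtains x where "m = Poly_Mapping.single x 1"
proof -
  \<comment> \<open>A sum of naturals equal to 1 has one summand 1 and all others 0; since keys have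
    nonzero exponents, \<open>x\<close> is the only key.\<close>
  obtain x where x: "x \<in> Poly_Mapping.keys m" "Poly_Mapping.lookup m x = 1"
      "\<forall>y\<in>Poly_Mapping.keys m. x \<noteq> y \<longrightarrow> Poly_Mapping.lookup m y = 0"
    using assms by (auto simp: mdegree_def sum_eq_Suc0_iff)
  have "m = Poly_Mapping.single x 1"
    by (rule poly_mapping_eqI) (use x in \<open>auto simp: lookup_single when_def in_keys_iff\<close>)
  with that show thesis .
qed

lemma cut_hom_linear_monomial:
  "cut_hom E (Poly_Mapping.single (Poly_Mapping.single P 1) c) =
     Poly_Mapping.single (cut_exponent E P) c"
  by (simp add: cut_hom_def subst_single cut_monomial_eq_single const_def mult_single)

text \<open>Distinct variables go to distinct monomials, so no terms of a linear form can cancel in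
  its image.\<close>

lemma linear_form_cut_ideal_eq_0:
  assumes "finite E" and inj: "inj_on (cut E) (partitions2 V)"
    and p: "p \<in> graded_part 1 (cut_ideal V E)"
  shows "p = 0"
proof (rule ccontr)
  let ?l = "Poly_Mapping.lookup p"
  assume "p \<noteq> 0"
  then obtain m where m: "m \<in> Poly_Mapping.keys p"
    by (metis keys_eq_empty all_not_in_conv)
  have linear: "\<exists>P\<in>partitions2 V. n = Poly_Mapping.single P 1" if "n \<in> Poly_Mapping.keys p" for n
  proof -
    from p that have "mdegree n = 1" and sub: "Poly_Mapping.keys n \<subseteq> partitions2 V"
      by (auto simp: graded_part_def cut_ideal_def poly_ring_def)
    from this(1) obtain P where "n = Poly_Mapping.single P 1"
      by (rule mdegree_eq_1E)
    with sub show ?thesis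
      by auto
  qed
  from linear[OF m] obtain P where P: "P \<in> partitions2 V" "m = Poly_Mapping.single P 1"
    by blast
  \<comment> \<open>Only the term at \<open>m\<close> contributes to the coefficient of the image at
    \<open>cut_exponent E P\<close>, which is therefore the nonzero \<open>?l m\<close>.\<close>
  have coeff: "Poly_Mapping.lookup (cut_hom E (Poly_Mapping.single n (?l n))) (cut_exponent E P) =
      (if n = m then ?l m else 0)" if "n \<in> Poly_Mapping.keys p" for n
  proof -
    from linear[OF that] obtain Q where Q: "Q \<in> partitions2 V" "n = Poly_Mapping.single Q 1"
      by blast
    have "cut_exponent E Q = cut_exponent E P \<longleftrightarrow> Q = P"
      using inj P(1) Q(1) by (auto simp: cut_exponent_eq_iff[OF \<open>finite E\<close>] dest: inj_onD)
    moreover have "n = m \<longleftrightarrow> Q = P"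
      unfolding P(2) Q(2) by (metis keys_single singleton_inject zero_neq_one)
    ultimately show ?thesis
      unfolding Q(2) cut_hom_linear_monomial by (auto simp: lookup_single when_def)
  qed
  have "cut_hom E p =
      (\<Sum>n\<in>Poly_Mapping.keys p. cut_hom E (Poly_Mapping.single n (?l n)))"
    by (simp only: cut_hom_def subst_sum[symmetric] sum_single_keys)
  then have "Poly_Mapping.lookup (cut_hom E p) (cut_exponent E P) =
      (\<Sum>n\<in>Poly_Mapping.keys p. if n = m then ?l m else 0)"
    by (simp add: lookup_sum coeff)
  also have "\<dots> = ?l m"
    using m by simp
  finally have "cut_hom E p \<noteq> 0"
    using m by (auto simp: in_keys_iff)
  with p show False
    by (simp add: graded_part_def cut_ideal_def)
qed

lemma binomial_in_graded_part_cut_ideal: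
  assumes "P \<in> partitions2 V" "Q \<in> partitions2 V" "cut E P = cut E Q"
  shows "var P - var Q \<in> graded_part 1 (cut_ideal V E)"
proof -
  \<comment> \<open>The image of the difference comes from additivity applied to
    \<open>(var P - var Q) + var Q\<close>.\<close>
  have "cut_hom E (var P - var Q) + cut_hom E (var Q) = cut_hom E (var P)"
    by (simp flip: subst_add add: cut_hom_def)
  then have "cut_hom E (var P - var Q) = 0"
    using assms(3) by (simp add: cut_hom_var cut_monomial_def)
  moreover have "Poly_Mapping.keys (var P - var Q :: ('a set set, 'b) mpoly) \<subseteq>
      {Poly_Mapping.single P 1, Poly_Mapping.single Q 1}"
    using keys_diff[of "var P" "var Q :: ('a set set, 'b) mpoly"] by (auto simp: var_def)
  ultimately show ?thesis
    using assms(1,2)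
    by (fastforce simp: graded_part_def cut_ideal_def poly_ring_def mdegree_def)
qed

lemma var_eq_iff: "(var x :: ('x, 'k::comm_ring_1) mpoly) = var y \<longleftrightarrow> x = y"
  unfolding var_def by (metis keys_single singleton_inject zero_neq_one)

lemma linear_form_cut_ideal_iff:
  assumes "finite E"
  shows "graded_part 1 (cut_ideal V E :: ('v set set, 'k::comm_ring_1) mpoly set) \<noteq> {0} \<longleftrightarrow>
    \<not> inj_on (cut E) (partitions2 V)"
proof
  \<comment> \<open>As 0 always belongs to the graded part, differing from \<open>{0}\<close> means
    containing a nonzero linear form.\<close>
  have "(0 :: ('v set set, 'k) mpoly) \<in> graded_part 1 (cut_ideal V E)"
    by (simp add: graded_part_def cut_ideal_def poly_ring_def cut_hom_def)
  then show "graded_part 1 (cut_ideal V E :: ('v set set, 'k) mpoly set) \<noteq> {0} \<Longrightarrow>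
      \<not> inj_on (cut E) (partitions2 V)"
    using linear_form_cut_ideal_eq_0[OF assms] by blast
next
  assume "\<not> inj_on (cut E) (partitions2 V)"
  then obtain P Q where "P \<in> partitions2 V" "Q \<in> partitions2 V" "cut E P = cut E Q" "P \<noteq> Q"
    by (auto simp: inj_on_def)
  then show "graded_part 1 (cut_ideal V E :: ('v set set, 'k) mpoly set) \<noteq> {0}"
    using binomial_in_graded_part_cut_ideal[of P V Q E]
    by (metis singletonD right_minus_eq var_eq_iff)
qed

lemma edge_in_cut_iff:
  assumes "A \<inter> B = {}" "{u, v} \<in> E" "{u, v} \<subseteq> A \<union> B"
  shows "{u, v} \<in> cut E {A, B} \<longleftrightarrow> (u \<in> A \<longleftrightarrow> v \<notin> A)"
  using assms unfolding cut_pair[OF assms(1)] by (auto simp: doubleton_eq_iff)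

text \<open>Whether \<open>A\<close> and \<open>C\<close> agree at a vertex is preserved along every
  edge, hence constant on a connected graph.\<close>

lemma inj_on_cut_if_connected:
  assumes E: "\<forall>e\<in>E. e \<subseteq> V" and "V \<noteq> {}" and conn: "graph_connected V E"
  shows "inj_on (cut E) (partitions2 V)"
proof (rule inj_onI)
  fix P Q
  assume "P \<in> partitions2 V" "Q \<in> partitions2 V" and cut: "cut E P = cut E Q"
  then obtain A B C D where P: "P = {A, B}" "A \<union> B = V" "A \<inter> B = {}"
    and Q: "Q = {C, D}" "C \<union> D = V" "C \<inter> D = {}"
    by (auto simp: partitions2_def)
  obtain u where "u \<in> V"
    using \<open>V \<noteq> {}\<close> by blast
  have *: "(w \<in> A \<longleftrightarrow> w \<in> C) \<longleftrightarrow> (u \<in> A \<longleftrightarrow> u \<in> C)" if "w \<in> V" for w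
  proof -
    have "(u, w) \<in> {(x, y). {x, y} \<in> E}\<^sup>*"
      using conn \<open>u \<in> V\<close> that by (auto simp: graph_connected_def)
    then show ?thesis
    proof induction
      case (step x y)
      then have e: "{x, y} \<in> E" "{x, y} \<subseteq> V"
        using E by auto
      \<comment> \<open>Equal cuts: the edge is separated by \<open>A|B\<close> exactly when it is
        separated by \<open>C|D\<close>.\<close>
      have "(x \<in> A \<longleftrightarrow> y \<notin> A) \<longleftrightarrow> (x \<in> C \<longleftrightarrow> y \<notin> C)"
        using edge_in_cut_iff[of A B x y E] edge_in_cut_iff[of C D x y E] e P Q cut by simp
      with step.IH show ?case
        by blast
    qed simp
  qed
  have compl: "B = V - A" "D = V - C"
    using P(2,3) Q(2,3) by auto
  \<comment> \<open>Agreement everywhere gives \<open>A = C\<close>, disagreement everywhere gives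
    \<open>A = D\<close>; both yield the same unordered partition.\<close>
  have "A = C \<or> A = D"
  proof (cases "u \<in> A \<longleftrightarrow> u \<in> C")
    case True
    then have "\<forall>w\<in>V. w \<in> A \<longleftrightarrow> w \<in> C"
      using * by simp
    then show ?thesis
      using P(2) Q(2) by auto
  next
    case False
    then have "\<forall>w\<in>V. w \<in> A \<longleftrightarrow> w \<notin> C"
      using * by simp
    then show ?thesis
      using P(2) compl(2) by auto
  qed
  then show "P = Q"
    using P(1,2) Q(1,2) compl by auto
qed

lemma not_inj_on_cut_if_disconnected:
  assumes "\<not> graph_connected V E"
  shows "\<not> inj_on (cut E) (partitions2 V)"
proof -
  let ?R = "{(x, y). {x, y} \<in> E}\<^sup>*"
  obtain u v where uv: "u \<in> V" "v \<in> V" "(u, v) \<notin> ?R"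
    using assms by (auto simp: graph_connected_def)
  define C where "C = {w \<in> V. (u, w) \<in> ?R}"
  \<comment> \<open>An edge leaving \<open>C\<close> would extend a path from \<open>u\<close> to a
    vertex outside \<open>C\<close>.\<close>
  have "{i, j} \<notin> E" if "i \<in> C" "j \<in> V - C" for i j
    using that by (auto simp: C_def intro: rtrancl_into_rtrancl)
  then have "cut E {C, V - C} = cut E {V, {}}"
    by (auto simp: cut_pair)
  moreover have "{C, V - C} \<in> partitions2 V" "{V, {}} \<in> partitions2 V"
    by (auto simp: partitions2_def C_def)
  \<comment> \<open>Both parts are nonempty: \<open>u\<close> lies in \<open>C\<close> and
    \<open>v\<close> in \<open>V - C\<close>.\<close>
  moreover have "{C, V - C} \<noteq> {V, {}}"
    using uv by (auto simp: C_def doubleton_eq_iff)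
  ultimately show ?thesis
    by (auto dest: inj_onD)
qed

theorem proposition3p2:
  fixes V :: "'v set" and E :: "'v set set"
  assumes "simple_graph V E" and "card E \<ge> 1"
  shows "graded_part 1 (cut_ideal V E :: ('v set set, 'k::field) mpoly set) \<noteq> {0} \<longleftrightarrow>
    \<not> graph_connected V E"
proof -
  \<comment> \<open>Infinite sets have \<open>card\<close> 0, so \<open>card E \<ge> 1\<close>
    yields finiteness of \<open>E\<close>.\<close>
  have "finite E" "\<forall>e\<in>E. e \<subseteq> V" "V \<noteq> {}"
    using assms by (auto simp: simple_graph_def card_ge_0_finite)
  then show ?thesis
    using linear_form_cut_ideal_iff inj_on_cut_if_connected not_inj_on_cut_if_disconnected
    by metis
qed

end
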